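(* Let $T>0$ and let $N(ds,dz)$ be a Poisson random measure on $[0,T]\times\mathbb{R}_0$ with intensity $ds\,\nu(dz)$, where $\nu$ is a Lévy measure satisfying conditions (L1)–(L4) of the context with some constants $\beta>1$, $C>0$. Let $\kappa:[0,T]\to\mathbb{R}$ be a bounded deterministic measurable function such that $\int_0^t\kappa(s)^2\,ds>0$ for all $t\in(0,T]$. Let $\eta:\mathbb{R}_0\to[0,\infty)$ be measurable with $\nu(\{z:\eta(z)>0\})=\infty$. Then for every $t\in(0,T]$, $$\int_0^t\int_{\mathbb{R}_0}\kappa(s)^2\,\eta(z)\,N(ds,dz)>0\qquad\text{a.s.},$$ where the integral is understood as an extended nonnegative random variable (possibly $+\infty$).
   Context: $\mathbb{R}_0:=\mathbb{R}\setminus\{0\}$. Conditions on $\nu$: $\nu(dz)=c(z)\,dz$ for a positive function $c\in C^1(\mathbb{R}_0)$, and there are constants $\beta>1$, $C>0$ such that (L1) $\int_{\mathbb{R}_0}(1\wedge|z|^2)\,\nu(dz)<\infty$; (L2) for every $p\in(1,\beta)$, $\lim_{n\to\infty}\int_{|z|>n}|z|^p\,\nu(dz)=0$; (L3) $\sup_{n\in\mathbb{N}}\big|\int_{1\le|z|\le n}z\,\nu(dz)\big|<\infty$ and $\nu(\{0<|z|\le\varepsilon\})=+\infty$ for every $\varepsilon>0$; (L4) $|c'(z)/c(z)|\le C(1\vee |z|^{-1})$ for all $z\neq0$. *)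

theory Defs
  imports "HOL-Probability.Probability"
begin

text \<open>The measure \<open>\<nu>(dz) = c(z) dz\<close>; its underlying space is the punctured line, so \<open>c 0\<close> is irrelevant.\<close>

definition levy_density_measure :: "(real \<Rightarrow> real) \<Rightarrow> real measure" where
  "levy_density_measure c = density (restrict_space lborel (- {0})) (\<lambda>z. ennreal (c z))"

definition levy_conditions :: "(real \<Rightarrow> real) \<Rightarrow> real \<Rightarrow> real \<Rightarrow> bool" where
  "levy_conditions c \<beta> C \<longleftrightarrow>
     (\<forall>z. z \<noteq> 0 \<longrightarrow> c z > 0) \<and> c C1_differentiable_on (- {0}) \<and> \<beta> > 1 \<and> C > 0 \<and>
     (\<integral>\<^sup>+z. ennreal (min 1 (\<bar>z\<bar>\<^sup>2)) \<partial>levy_density_measure c) < \<infinity> \<and>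
     (\<forall>p. 1 < p \<and> p < \<beta> \<longrightarrow>
        (\<lambda>n::nat. \<integral>\<^sup>+z\<in>{z. \<bar>z\<bar> > real n}. ennreal (\<bar>z\<bar> powr p) \<partial>levy_density_measure c)
          \<longlonglongrightarrow> 0) \<and>
     \<comment> \<open>these Bochner integrals exist by the first integrability condition\<close>
     bdd_above (range (\<lambda>n::nat.
        \<bar>LINT z:{z. 1 \<le> \<bar>z\<bar> \<and> \<bar>z\<bar> \<le> real n}|levy_density_measure c. z\<bar>)) \<and>
     (\<forall>\<epsilon>>0. emeasure (levy_density_measure c) {z. 0 < \<bar>z\<bar> \<and> \<bar>z\<bar> \<le> \<epsilon>} = \<infinity>) \<and>
     (\<forall>z. z \<noteq> 0 \<longrightarrow> \<bar>deriv c z / c z\<bar> \<le> C * max 1 (inverse \<bar>z\<bar>))"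

text \<open>A Poisson random measure \<open>N\<close> with intensity \<open>\<mu>\<close> on a probability space \<open>M\<close>.
  For \<open>\<sigma>\<close>-finite \<open>\<mu>\<close> the remaining part of the usual definition, namely \<open>N(A) = \<infinity>\<close> almost surely
  whenever \<open>\<mu>(A) = \<infinity>\<close>, follows from these axioms and is therefore not assumed.
  When \<open>\<mu>(A) = 0\<close>, the Poisson weights are those of the point mass at 0, since \<open>0 ^ 0 = 1\<close>.\<close>

locale poisson_random_measure = prob_space M for M :: "'w measure" +
  fixes \<mu> :: "'a measure" and N :: "'w \<Rightarrow> 'a measure"
  assumes sets_N: "\<And>\<omega>. \<omega> \<in> space M \<Longrightarrow> sets (N \<omega>) = sets \<mu>"
    and measurable_N: "\<And>A. A \<in> sets \<mu> \<Longrightarrow> (\<lambda>\<omega>. emeasure (N \<omega>) A) \<in> borel_measurable M"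
    and poisson_N: "\<And>A k. A \<in> sets \<mu> \<Longrightarrow> emeasure \<mu> A < \<infinity> \<Longrightarrow>
      prob {\<omega> \<in> space M. emeasure (N \<omega>) A = of_nat k}
        = exp (- measure \<mu> A) * measure \<mu> A ^ k / fact k"
    and indep_N: "\<And>(A :: nat \<Rightarrow> 'a set) n. (\<And>i. i < n \<Longrightarrow> A i \<in> sets \<mu>) \<Longrightarrow>
      disjoint_family_on A {..<n} \<Longrightarrow>
      indep_vars (\<lambda>_. borel) (\<lambda>i \<omega>. emeasure (N \<omega>) (A i)) {..<n}"

end

theory Submission
  imports Defs
begin

text \<open>Let \<open>A\<close> be the set where the integrand is positive. It is a product of a set of positive
  Lebesgue measure with a set of infinite \<open>\<nu>\<close>-measure, so its intensity is infinite.
  Exhausting \<open>A\<close> by sets \<open>A\<^sub>n\<close> of finite intensity, the probability that \<open>N\<close> does not charge \<open>A\<close>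
  is at most \<open>exp (- \<mu>(A\<^sub>n))\<close> for every \<open>n\<close>, hence zero.\<close>

lemma (in poisson_random_measure) AE_emeasure_pos:
  assumes sf: "sigma_finite_measure \<mu>" and A: "A \<in> sets \<mu>" and inf: "emeasure \<mu> A = \<infinity>"
  shows "AE \<omega> in M. emeasure (N \<omega>) A > 0"
proof -
  interpret sigma_finite_measure \<mu> by fact
  obtain B :: "nat \<Rightarrow> 'a set" where B: "range B \<subseteq> sets \<mu>" "(\<Union>i. B i) = space \<mu>"
    "\<And>i. emeasure \<mu> (B i) \<noteq> \<infinity>" "incseq B"
    using sigma_finite_incseq by metis
  define D where "D n = A \<inter> B n" for n
  have D_sets: "D n \<in> sets \<mu>" for n
    using A B(1) by (auto simp: D_def)
  have D_fin: "emeasure \<mu> (D n) < \<infinity>" for n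
  proof -
    have "emeasure \<mu> (D n) \<le> emeasure \<mu> (B n)"
      using B(1) by (intro emeasure_mono) (auto simp: D_def)
    with B(3)[of n] show ?thesis
      by (auto simp: less_top[symmetric] top_unique)
  qed
  have UN_D: "(\<Union>n. D n) = A"
    using B(2) sets.sets_into_space[OF A] by (auto simp: D_def)
  have "range D \<subseteq> sets \<mu>" "incseq D"
    using D_sets B(4) by (auto simp: D_def incseq_def)
  then have lim: "(\<lambda>n. emeasure \<mu> (D n)) \<longlonglongrightarrow> \<infinity>"
    using Lim_emeasure_incseq[where A = D and M = \<mu>] by (simp only: UN_D inf)
  let ?Z = "{\<omega> \<in> space M. emeasure (N \<omega>) A = 0}"
  have Z: "?Z \<in> events"
    using measurable_N[OF A] by measurable
  \<comment> \<open>If \<open>N \<omega>\<close> misses \<open>A\<close>, it misses the subset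
    \<open>D n\<close>; since \<open>D n\<close> has finite intensity, the latter event has the
    Poisson weight at \<open>k = 0\<close>.\<close>
  have bound: "prob ?Z \<le> exp (- measure \<mu> (D n))" for n
  proof -
    have "{\<omega> \<in> space M. emeasure (N \<omega>) (D n) = 0} \<in> events"
      using measurable_N[OF D_sets[of n]] by measurable
    moreover have "?Z \<subseteq> {\<omega> \<in> space M. emeasure (N \<omega>) (D n) = 0}"
    proof (intro subsetI CollectI conjI; clarify)
      fix \<omega> assume \<omega>: "\<omega> \<in> space M" "emeasure (N \<omega>) A = 0"
      show "emeasure (N \<omega>) (D n) = 0"
        by (rule emeasure_eq_0[of A]) (use \<omega> A sets_N[OF \<omega>(1)] in \<open>simp_all add: D_def\<close>)
    qed
    ultimately have "prob ?Z \<le> prob {\<omega> \<in> space M. emeasure (N \<omega>) (D n) = 0}"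
      by (intro finite_measure_mono)
    also have "\<dots> = exp (- measure \<mu> (D n))"
      using poisson_N[OF D_sets D_fin, of n 0] by simp
    finally show ?thesis .
  qed
  \<comment> \<open>Some \<open>D n\<close> has intensity above \<open>- ln e\<close>, which makes
    the exponential bound at most \<open>e\<close>. For \<open>e \<ge> 1\<close> the value
    \<open>ennreal (- ln e)\<close> is truncated to 0; the strict inequality still descends to the
    reals, because \<open>ennreal\<close> is monotone.\<close>
  have "prob ?Z \<le> e" if "e > 0" for e
  proof -
    have "eventually (\<lambda>n. emeasure \<mu> (D n) > ennreal (- ln e)) sequentially"
      using lim by (intro order_tendstoD) auto
    then obtain n where "emeasure \<mu> (D n) > ennreal (- ln e)"
      by (auto dest: eventually_happens)
    then have "ennreal (- ln e) < ennreal (measure \<mu> (D n))"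
      using D_fin[of n] by (simp add: emeasure_eq_ennreal_measure)
    then have "measure \<mu> (D n) > - ln e"
      by (meson ennreal_leI not_le)
    then have "exp (- measure \<mu> (D n)) \<le> exp (ln e)"
      by simp
    with bound[of n] that show ?thesis by simp
  qed
  then have "prob ?Z \<le> 0"
    by (rule dense_ge)
  then have "prob ?Z = 0"
    by (intro antisym measure_nonneg)
  then have "AE \<omega> in M. \<omega> \<notin> ?Z"
    using prob_eq_0[OF Z] by blast
  then show ?thesis
    by (rule AE_mp) (intro AE_I2, simp add: zero_less_iff_neq_zero)
qed

lemma sets_levy_density_measure [measurable_cong]:
  "sets (levy_density_measure c) = sets (restrict_space borel (- {0}))"
  by (simp add: levy_density_measure_def sets_restrict_space)

lemma space_levy_density_measure: "space (levy_density_measure c) = - {0}"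
  by (simp add: levy_density_measure_def space_restrict_space)

lemma sigma_finite_restrict_lborel:
  assumes "S \<in> sets borel"
  shows "sigma_finite_measure (restrict_space lborel S)"
  using assms by (intro sigma_finite_measure_restrict_space lborel.sigma_finite_measure_axioms) auto

text \<open>A density with finite values over a sigma-finite measure is again sigma-finite, and
  \<open>ennreal (c z)\<close> is never infinite; continuity supplies measurability. The product
  measure formula and the exhaustion of the intensity rest on this.\<close>

lemma sigma_finite_levy_density_measure:
  assumes "continuous_on (- {0}) c"
  shows "sigma_finite_measure (levy_density_measure c)"
proof -
  interpret sigma_finite_measure "restrict_space lborel (- {0} :: real set)"
    by (rule sigma_finite_restrict_lborel) auto
  have "c \<in> borel_measurable (restrict_space borel (- {0}))"
    by (rule borel_measurable_continuous_on_restrict) fact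
  then have "(\<lambda>z. ennreal (c z)) \<in> borel_measurable (restrict_space lborel (- {0}))"
    by (simp cong: measurable_cong_sets add: sets_restrict_space)
  then show ?thesis
    unfolding levy_density_measure_def
    by (subst sigma_finite_iff_density_finite) auto
qed

theorem lemma6p5:
  fixes M :: "'w measure" and N :: "'w \<Rightarrow> (real \<times> real) measure"
    and T \<beta> C :: real and c \<kappa> \<eta> :: "real \<Rightarrow> real"
  assumes "T > 0"
    and "levy_conditions c \<beta> C"
    and "poisson_random_measure M
           (restrict_space lborel {0..T} \<Otimes>\<^sub>M levy_density_measure c) N"
    and "\<kappa> \<in> borel_measurable (restrict_space borel {0..T})"
    and "bounded (\<kappa> ` {0..T})"
    and "\<And>t. t \<in> {0<..T} \<Longrightarrow> (LINT s:{0..t}|lborel. (\<kappa> s)\<^sup>2) > 0"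
    and "\<eta> \<in> borel_measurable (restrict_space borel (- {0}))"
    and "\<And>z. z \<noteq> 0 \<Longrightarrow> \<eta> z \<ge> 0"
    and "emeasure (levy_density_measure c) {z. z \<noteq> 0 \<and> \<eta> z > 0} = \<infinity>"
  shows "\<forall>t\<in>{0<..T}. AE \<omega> in M.
           (\<integral>\<^sup>+(s, z)\<in>{0<..t} \<times> (- {0}). ennreal ((\<kappa> s)\<^sup>2 * \<eta> z) \<partial>N \<omega>) > 0"
proof
  fix t assume t: "t \<in> {0<..T}"
  let ?L = "restrict_space lborel {0..T}" and ?V = "levy_density_measure c"
  let ?P = "?L \<Otimes>\<^sub>M ?V"
  interpret poisson_random_measure M ?P N by fact
  have "continuous_on (- {0}) c"
    using assms(2) by (auto simp: levy_conditions_def intro: C1_differentiable_imp_continuous_on)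
  then interpret \<nu>: sigma_finite_measure ?V
    by (rule sigma_finite_levy_density_measure)
  interpret \<lambda>: sigma_finite_measure ?L
    by (rule sigma_finite_restrict_lborel) auto
  interpret pair_sigma_finite ?L ?V ..
  have sp: "space ?P = {0..T} \<times> (- {0})"
    by (simp add: space_pair_measure space_restrict_space space_levy_density_measure)
  have \<kappa>[measurable]: "\<kappa> \<in> borel_measurable ?L"
    using assms(4) by (simp cong: measurable_cong_sets add: sets_restrict_space)
  have \<eta>[measurable]: "\<eta> \<in> borel_measurable ?V"
    using assms(7) by (simp cong: measurable_cong_sets add: sets_levy_density_measure)
  \<comment> \<open>\<open>K \<times> H\<close> will be exactly the set where the integrand is
    nonzero. The condition is \<open>\<kappa> s \<noteq> 0\<close> since only the square of
    \<open>\<kappa>\<close> enters.\<close>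
  define K where "K = {s \<in> space ?L. s \<in> {0<..t} \<and> \<kappa> s \<noteq> 0}"
  define H where "H = {z \<in> space ?V. \<eta> z > 0}"
  have sub: "{0<..t} \<in> sets ?L"
    using t by (subst sets_restrict_space_iff) auto
  then have K: "K \<in> sets ?L"
    unfolding K_def by measurable
  have H: "H \<in> sets ?V"
    unfolding H_def by measurable
  \<comment> \<open>If \<open>K\<close> were null, the square of \<open>\<kappa>\<close> would
    vanish almost everywhere on \<open>{0..t}\<close> and its integral would be 0, against the
    assumption.\<close>
  have "emeasure ?L K \<noteq> 0"
  proof
    assume "emeasure ?L K = 0"
    then have "emeasure lborel K = 0"
      using emeasure_restrict_space[of "{0..T}" lborel K]
        sets.sets_into_space[OF K]
      by (simp add: space_restrict_space)
    moreover have "K \<in> sets lborel"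
      using K by (auto simp: sets_restrict_space_iff)
    ultimately have "AE s in lborel. s \<notin> K"
      by (intro AE_not_in) auto
    \<comment> \<open>The point 0 lies in \<open>{0..t}\<close> but never in \<open>K\<close>, so it
      is set aside here and then discarded as a null singleton.\<close>
    then have "AE s in lborel. s \<noteq> 0 \<longrightarrow> indicator {0..t} s *\<^sub>R (\<kappa> s)\<^sup>2 = 0"
      by eventually_elim
        (use t in \<open>auto simp: K_def space_restrict_space indicator_def\<close>)
    with AE_lborel_singleton[of 0]
    have "AE s in lborel. indicator {0..t} s *\<^sub>R (\<kappa> s)\<^sup>2 = 0"
      by eventually_elim auto
    then have "(LINT s:{0..t}|lborel. (\<kappa> s)\<^sup>2) = 0"
      unfolding set_lebesgue_integral_def by (rule integral_eq_zero_AE)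
    with assms(6)[OF t] show False by simp
  qed
  moreover have "H = {z. z \<noteq> 0 \<and> \<eta> z > 0}"
    by (auto simp: H_def space_levy_density_measure)
  \<comment> \<open>In the extended nonnegative reals a nonzero factor times infinity is infinity,
    so no lower bound on the measure of \<open>K\<close> is required.\<close>
  ultimately have "emeasure ?P (K \<times> H) = \<infinity>"
    using assms(9)
    by (subst \<nu>.emeasure_pair_measure_Times[OF K H]) (auto simp: ennreal_mult_eq_top_iff)
  then have AE: "AE \<omega> in M. emeasure (N \<omega>) (K \<times> H) > 0"
    by (intro AE_emeasure_pos sigma_finite_measure_axioms) (use K H in auto)
  let ?f = "\<lambda>x. (case x of (s, z) \<Rightarrow> ennreal ((\<kappa> s)\<^sup>2 * \<eta> z)) * indicator ({0<..t} \<times> (- {0})) x"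
  have "{0<..t} \<times> (- {0}) \<in> sets ?P"
    using sub sets.top[of ?V] by (intro pair_measureI) (auto simp: space_levy_density_measure)
  then have f: "?f \<in> borel_measurable ?P"
    by measurable
  have pos: "(\<kappa> s)\<^sup>2 * \<eta> z > 0 \<longleftrightarrow> \<kappa> s \<noteq> 0 \<and> \<eta> z > 0" if "z \<noteq> 0" for s z
    using assms(8)[OF that] by (auto simp: zero_less_mult_iff)
  \<comment> \<open>Points with \<open>z = 0\<close> lie on neither side; elsewhere the sign of the
    product is settled by \<open>pos\<close>.\<close>
  have supp: "{x \<in> space ?P. ?f x \<noteq> 0} = K \<times> H"
  proof (intro set_eqI, clarify)
    fix s z
    show "(s, z) \<in> {x \<in> space ?P. ?f x \<noteq> 0} \<longleftrightarrow> (s, z) \<in> K \<times> H"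
    proof (cases "z = 0")
      case False
      then show ?thesis
        using pos[OF False, of s]
        by (simp add: sp K_def H_def space_restrict_space space_levy_density_measure
            indicator_def ennreal_eq_0_iff not_le conj_ac)
    qed (simp add: sp H_def space_levy_density_measure)
  qed
  \<comment> \<open>The rest is pathwise: a nonnegative integral vanishes only if the support of the
    integrand is null for \<open>N \<omega>\<close>. Measurability and the underlying space carry
    over from \<open>?P\<close>, which has the same measurable sets.\<close>
  have "(\<integral>\<^sup>+x. ?f x \<partial>N \<omega>) > 0"
    if \<omega>: "\<omega> \<in> space M" and charged: "emeasure (N \<omega>) (K \<times> H) > 0" for \<omega>
  proof -
    note sets = sets_N[OF \<omega>]
    have "?f \<in> borel_measurable (N \<omega>)"
      using f measurable_cong_sets[OF sets refl] by blast
    from nn_integral_0_iff[OF this] charged show ?thesis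
      unfolding sets_eq_imp_space_eq[OF sets] supp zero_less_iff_neq_zero by blast
  qed
  then show "AE \<omega> in M.
      (\<integral>\<^sup>+(s, z)\<in>{0<..t} \<times> (- {0}). ennreal ((\<kappa> s)\<^sup>2 * \<eta> z) \<partial>N \<omega>) > 0"
    by (intro AE_mp[OF AE AE_I2] impI)
qed

end
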